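(* Let $r,\nu\in(0,\infty)$ and $p\in(0,1)$. The $\mathrm{CMNB}(r,\nu,p)$ distribution is log-concave if $r\ge 1$ and log-convex if $r\le 1$.
   Context: For $r,\nu\in(0,\infty)$ and $p\in(0,1)$, a random variable $X$ follows the COM-negative binomial distribution $\mathrm{CMNB}(r,\nu,p)$ if $$\mathrm{P}(X=k)=\left(\frac{\Gamma(r+k)}{k!\,\Gamma(r)}\right)^{\nu}p^k(1-p)^r\frac{1}{C(r,\nu,p)},\quad k=0,1,2,\ldots,\qquad C(r,\nu,p)=\sum_{i=0}^{\infty}\left(\frac{\Gamma(r+i)}{i!\,\Gamma(r)}\right)^{\nu}p^i(1-p)^r .$$ A discrete distribution on $\{0,1,2,\ldots\}$ with $p_k=\mathrm{P}(X=k)$ is log-concave (respectively log-convex) if $\frac{p_{k+1}p_{k-1}}{p_k^2}\le 1$ (respectively $\ge 1$) for all $k\ge 1$. *)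

theory Defs
  imports "HOL-Probability.Probability" "HOL-Real_Asymp.Real_Asymp"
begin

definition cmnb_term :: "real \<Rightarrow> real \<Rightarrow> real \<Rightarrow> nat \<Rightarrow> real" where
  "cmnb_term r \<nu> p k =
     (Gamma (r + real k) / (fact k * Gamma r)) powr \<nu> * p ^ k * (1 - p) powr r"

definition cmnb_const :: "real \<Rightarrow> real \<Rightarrow> real \<Rightarrow> real" where
  "cmnb_const r \<nu> p = (\<Sum>i. cmnb_term r \<nu> p i)"

(* embed_pmf is only meaningful when the given masses are nonnegative and sum to 1;
   pmf_CMNB below confirms this for all r, \<nu> > 0 and 0 < p < 1. *)
definition CMNB :: "real \<Rightarrow> real \<Rightarrow> real \<Rightarrow> nat pmf" where
  "CMNB r \<nu> p = embed_pmf (\<lambda>k. cmnb_term r \<nu> p k * (1 / cmnb_const r \<nu> p))"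

(* The quotients are the intended ones when all point masses are nonzero, as they are for
   CMNB (pmf_CMNB_pos); with a zero mass in the denominator the quotient is 0 by convention. *)
definition log_concave_pmf :: "nat pmf \<Rightarrow> bool" where
  "log_concave_pmf P \<longleftrightarrow> (\<forall>k\<ge>1. pmf P (k + 1) * pmf P (k - 1) / (pmf P k)\<^sup>2 \<le> 1)"

definition log_convex_pmf :: "nat pmf \<Rightarrow> bool" where
  "log_convex_pmf P \<longleftrightarrow> (\<forall>k\<ge>1. pmf P (k + 1) * pmf P (k - 1) / (pmf P k)\<^sup>2 \<ge> 1)"

lemma cmnb_term_pos:
  assumes "r > 0" "0 < p" "p < 1"
  shows "cmnb_term r \<nu> p k > 0"
proof -
  have "Gamma (r + real k) > 0" "Gamma r > 0"
    using assms by (auto intro!: Gamma_real_pos)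
  then have "Gamma (r + real k) / (fact k * Gamma r) > 0"
    by simp
  then have "(Gamma (r + real k) / (fact k * Gamma r)) powr \<nu> > 0"
    by (metis less_irrefl powr_gt_zero)
  then show ?thesis
    using assms by (simp add: cmnb_term_def)
qed

lemma cmnb_term_Suc:
  assumes "r > 0" "0 < p" "p < 1"
  shows "cmnb_term r \<nu> p (Suc k) =
    ((r + real k) / (1 + real k)) powr \<nu> * p * cmnb_term r \<nu> p k"
proof -
  have pos: "Gamma (r + real k) > 0" "Gamma r > 0"
    using assms by (auto intro!: Gamma_real_pos)
  have "Gamma (r + real (Suc k)) = (r + real k) * Gamma (r + real k)"
    using Gamma_plus1[of "r + real k"] assms pos
    by (metis Gamma_eq_zero_iff add.assoc add.commute less_irrefl of_nat_Suc)
  then have "Gamma (r + real (Suc k)) / (fact (Suc k) * Gamma r) =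
    ((r + real k) / (1 + real k)) * (Gamma (r + real k) / (fact k * Gamma r))"
    by (simp add: field_simps)
  then have "(Gamma (r + real (Suc k)) / (fact (Suc k) * Gamma r)) powr \<nu> =
    ((r + real k) / (1 + real k)) powr \<nu> * (Gamma (r + real k) / (fact k * Gamma r)) powr \<nu>"
    using assms pos by (simp only: powr_mult)
  then show ?thesis
    by (simp add: cmnb_term_def mult_ac)
qed

lemma summable_cmnb_term:
  assumes "r > 0" "0 < p" "p < 1"
  shows "summable (cmnb_term r \<nu> p)"
proof -
  have "(\<lambda>k. (r + real k) / (1 + real k)) \<longlonglongrightarrow> 1"
    by real_asymp
  then have "(\<lambda>k. ((r + real k) / (1 + real k)) powr \<nu> * p) \<longlonglongrightarrow> 1 powr \<nu> * p"
    by (intro tendsto_intros) auto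
  moreover have "1 powr \<nu> * p < (1 + p) / 2"
    using assms by simp
  ultimately have "eventually (\<lambda>k. ((r + real k) / (1 + real k)) powr \<nu> * p < (1 + p) / 2) sequentially"
    by (rule order_tendstoD(2))
  then obtain N where N: "((r + real k) / (1 + real k)) powr \<nu> * p < (1 + p) / 2" if "k \<ge> N" for k
    by (auto simp: eventually_sequentially)
  show ?thesis
  proof (rule summable_ratio_test)
    show "(1 + p) / 2 < 1"
      using assms by simp
    fix k assume "k \<ge> N"
    then have "cmnb_term r \<nu> p (Suc k) \<le> (1 + p) / 2 * cmnb_term r \<nu> p k"
      unfolding cmnb_term_Suc[OF assms]
      by (intro mult_right_mono less_imp_le[OF N] less_imp_le[OF cmnb_term_pos] assms)
    then show "norm (cmnb_term r \<nu> p (Suc k)) \<le> (1 + p) / 2 * norm (cmnb_term r \<nu> p k)"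
      using cmnb_term_pos[OF assms, of \<nu>] by (simp add: abs_of_pos)
  qed
qed

lemma cmnb_const_pos:
  assumes "r > 0" "0 < p" "p < 1"
  shows "cmnb_const r \<nu> p > 0"
  unfolding cmnb_const_def
  by (intro suminf_pos summable_cmnb_term cmnb_term_pos assms)

lemma pmf_CMNB:
  assumes "r > 0" "0 < p" "p < 1"
  shows "pmf (CMNB r \<nu> p) k = cmnb_term r \<nu> p k * (1 / cmnb_const r \<nu> p)"
  unfolding CMNB_def
proof (rule pmf_embed_pmf)
  show nonneg: "0 \<le> cmnb_term r \<nu> p j * (1 / cmnb_const r \<nu> p)" for j
    using cmnb_term_pos[OF assms, of \<nu> j] cmnb_const_pos[OF assms, of \<nu>] by simp
  have "(\<lambda>j. cmnb_term r \<nu> p j * (1 / cmnb_const r \<nu> p)) sums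
      (cmnb_const r \<nu> p * (1 / cmnb_const r \<nu> p))"
    unfolding cmnb_const_def by (intro sums_mult2 summable_sums summable_cmnb_term assms)
  then have "(\<lambda>j. cmnb_term r \<nu> p j * (1 / cmnb_const r \<nu> p)) sums 1"
    using cmnb_const_pos[OF assms, of \<nu>] by simp
  then show "(\<integral>\<^sup>+ j. ennreal (cmnb_term r \<nu> p j * (1 / cmnb_const r \<nu> p)) \<partial>count_space UNIV) = 1"
    unfolding nn_integral_count_space_nat
    by (subst suminf_ennreal_eq[OF nonneg]) auto
qed

lemma pmf_CMNB_pos:
  assumes "r > 0" "0 < p" "p < 1"
  shows "pmf (CMNB r \<nu> p) k > 0"
  using cmnb_term_pos[OF assms, of \<nu> k] cmnb_const_pos[OF assms, of \<nu>]
  by (simp add: pmf_CMNB[OF assms])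

end

theory Submission
  imports Defs
begin

text \<open>
  The ratio of consecutive masses is \<open>p * ((r + k) / (1 + k)) powr \<nu>\<close>, and
  \<open>(r + k) / (1 + k) = 1 + (r - 1) / (1 + k)\<close> is decreasing in \<open>k\<close> for \<open>r \<ge> 1\<close>
  and increasing for \<open>r \<le> 1\<close>.
\<close>

lemma pmf_CMNB_Suc:
  assumes "r > 0" "0 < p" "p < 1"
  shows "pmf (CMNB r \<nu> p) (Suc k) =
    ((r + real k) / (1 + real k)) powr \<nu> * p * pmf (CMNB r \<nu> p) k"
  by (simp add: pmf_CMNB[OF assms] cmnb_term_Suc[OF assms])

text \<open>The quotient compares two successive growth factors of the mass sequence, so
  \<open>p\<close> cancels and only the monotonicity of \<open>(r + k) / (1 + k)\<close> matters.
  The centre is \<open>Suc k\<close>, which avoids subtraction on naturals.\<close>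

lemma pmf_CMNB_quotient:
  assumes "r > 0" "0 < p" "p < 1"
  shows "pmf (CMNB r \<nu> p) (Suc (Suc k)) * pmf (CMNB r \<nu> p) k / (pmf (CMNB r \<nu> p) (Suc k))\<^sup>2 =
    (((r + real (Suc k)) / (1 + real (Suc k))) / ((r + real k) / (1 + real k))) powr \<nu>"
proof -
  define a where "a j = (r + real j) / (1 + real j)" for j
  have a: "a j > 0" for j
    using assms by (simp add: a_def add_pos_nonneg)
  \<comment> \<open>The recurrence expresses every mass through the one at \<open>k\<close>; that
    mass, \<open>p\<close> and \<open>a k\<close> are positive, so they can be cancelled.\<close>
  have "pmf (CMNB r \<nu> p) (Suc (Suc k)) * pmf (CMNB r \<nu> p) k / (pmf (CMNB r \<nu> p) (Suc k))\<^sup>2 =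
      a (Suc k) powr \<nu> / a k powr \<nu>"
    using pmf_CMNB_pos[OF assms, of \<nu> k] a[of k] assms
    unfolding pmf_CMNB_Suc[OF assms] a_def[symmetric]
    by (simp add: field_simps power2_eq_square)
  also have "\<dots> = (a (Suc k) / a k) powr \<nu>"
    using a by (simp add: powr_divide less_imp_le)
  finally show ?thesis
    by (simp only: a_def)
qed

theorem lemma2p1:
  fixes r \<nu> p :: real
  assumes "0 < r" and "0 < \<nu>" and "0 < p" and "p < 1"
  shows "(r \<ge> 1 \<longrightarrow> log_concave_pmf (CMNB r \<nu> p)) \<and>
         (r \<le> 1 \<longrightarrow> log_convex_pmf (CMNB r \<nu> p))"
proof (intro conjI impI)
  assume "r \<ge> 1"
  show "log_concave_pmf (CMNB r \<nu> p)"
    unfolding log_concave_pmf_def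
  proof (intro allI impI)
    fix k :: nat assume "k \<ge> 1"
    then obtain j where k: "k = Suc j"
      by (cases k) auto
    \<comment> \<open>Clearing the positive denominators leaves
      \<open>1 + j \<le> r + j\<close>.\<close>
    have "((r + real (Suc j)) / (1 + real (Suc j))) / ((r + real j) / (1 + real j)) \<le> 1"
      using \<open>0 < r\<close> \<open>r \<ge> 1\<close> by (simp add: divide_simps) (simp add: algebra_simps)
    \<comment> \<open>A base in [0, 1] stays at most 1 under the positive exponent
      \<open>\<nu>\<close>.\<close>
    then show "pmf (CMNB r \<nu> p) (k + 1) * pmf (CMNB r \<nu> p) (k - 1) / (pmf (CMNB r \<nu> p) k)\<^sup>2 \<le> 1"
      using assms pmf_CMNB_quotient[of r p \<nu> j] by (simp add: k powr_le1)
  qed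
next
  assume "r \<le> 1"
  show "log_convex_pmf (CMNB r \<nu> p)"
    unfolding log_convex_pmf_def
  proof (intro allI impI)
    fix k :: nat assume "k \<ge> 1"
    then obtain j where k: "k = Suc j"
      by (cases k) auto
    \<comment> \<open>The same cross-multiplication, now leaving
      \<open>r + j \<le> 1 + j\<close>.\<close>
    have "((r + real (Suc j)) / (1 + real (Suc j))) / ((r + real j) / (1 + real j)) \<ge> 1"
      using \<open>0 < r\<close> \<open>r \<le> 1\<close> by (simp add: divide_simps) (simp add: algebra_simps)
    then show "pmf (CMNB r \<nu> p) (k + 1) * pmf (CMNB r \<nu> p) (k - 1) / (pmf (CMNB r \<nu> p) k)\<^sup>2 \<ge> 1"
      using assms pmf_CMNB_quotient[of r p \<nu> j] by (simp add: k ge_one_powr_ge_zero)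
  qed
qed

end
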